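(* Let $\sigma\in\{1,-1\}$, let $(u_0,v_0)\in\mathcal{E}\times\mathcal{E}$, and consider $(u,v)\in\mathcal{C}^\infty(\mathbb{R},\mathcal{E}\times\mathcal{E})$ the solution to the system $$i\partial_t u=\Pi(|v|^2u),\qquad i\partial_t v=\sigma\,\Pi(|u|^2v),\qquad (t,z)\in\mathbb{R}\times\mathbb{C},\qquad u(0,\cdot)=u_0,\quad v(0,\cdot)=v_0.$$ Then for all $t\in\mathbb{R}$, $$\frac{\sqrt{\pi}\,\mathcal{H}(u_0,v_0)}{\|u_0\|_{L^2(\mathbb{C})}\|v_0\|^2_{L^2(\mathbb{C})}}\leq\|u(t)\|_{L^\infty(\mathbb{C})}\leq\frac{1}{\sqrt{\pi}}\|u_0\|_{L^2(\mathbb{C})},$$ $$\frac{\sqrt{\pi}\,\mathcal{H}(u_0,v_0)}{\|v_0\|_{L^2(\mathbb{C})}\|u_0\|^2_{L^2(\mathbb{C})}}\leq\|v(t)\|_{L^\infty(\mathbb{C})}\leq\frac{1}{\sqrt{\pi}}\|v_0\|_{L^2(\mathbb{C})}.$$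
   Context: $L$ is Lebesgue measure on $\mathbb{C}$. The Bargmann-Fock space is $\mathcal{E}=\{u(z)=e^{-|z|^2/2}f(z):\ f \text{ entire holomorphic}\}\cap L^2(\mathbb{C})$. $\Pi$ is the orthogonal projection onto $\mathcal{E}$, given by $[\Pi u](z)=\frac1\pi e^{-|z|^2/2}\int_{\mathbb{C}}e^{\overline{w}z-|w|^2/2}u(w)\,dL(w)$. The Hamiltonian is $\mathcal{H}(u,v)=\int_{\mathbb{C}}|u|^2|v|^2dL$. For every initial datum in $\mathcal{E}\times\mathcal{E}$ the system has a unique solution in $\mathcal{C}^\infty(\mathbb{R},\mathcal{E}\times\mathcal{E})$. *)

theory Defs
  imports "HOL-Analysis.Analysis" "HOL-Probability.Essential_Supremum"
begin

text \<open>
  Elements of the Bargmann-Fock space are represented by their unique continuous representatives,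
  i.e. by genuine functions on the complex plane, so that equality in the space is equality of
  functions. Lebesgue measure is \<^const>\<open>lborel\<close> on \<^typ>\<open>complex\<close>.
\<close>

definition L2 :: "(complex \<Rightarrow> complex) set" where
  "L2 = {u. u \<in> borel_measurable lborel \<and> integrable lborel (\<lambda>z. (cmod (u z))\<^sup>2)}"

definition L2_norm :: "(complex \<Rightarrow> complex) \<Rightarrow> real" where
  "L2_norm u = sqrt (LINT z|lborel. (cmod (u z))\<^sup>2)"

text \<open>The value is extended real; it is infinite when the function is essentially unbounded.\<close>

definition Linf_norm :: "(complex \<Rightarrow> complex) \<Rightarrow> ereal" where
  "Linf_norm u = esssup lborel (\<lambda>z. ereal (cmod (u z)))"

definition bargmann_fock :: "(complex \<Rightarrow> complex) set" where
  "bargmann_fock =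
     {\<lambda>z. of_real (exp (- (cmod z)\<^sup>2 / 2)) * f z | f. f holomorphic_on UNIV} \<inter> L2"

definition bf_proj :: "(complex \<Rightarrow> complex) \<Rightarrow> complex \<Rightarrow> complex" where
  "bf_proj u z = of_real (1 / pi * exp (- (cmod z)\<^sup>2 / 2)) *
     (LINT w|lborel. exp (cnj w * z - of_real ((cmod w)\<^sup>2 / 2)) * u w)"

definition hamiltonian :: "(complex \<Rightarrow> complex) \<Rightarrow> (complex \<Rightarrow> complex) \<Rightarrow> real" where
  "hamiltonian u v = (LINT z|lborel. (cmod (u z))\<^sup>2 * (cmod (v z))\<^sup>2)"

text \<open>
  Differentiability at time \<open>t\<close> of a curve in the Bargmann-Fock space, with respect to the norm of
  that space (the \<open>L\<^sup>2\<close> norm). Membership of the curve and of \<open>D\<close> in the space is part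
  of the notion; in particular every integral behind the norm below is that of an integrable
  function.
\<close>

definition has_bf_derivative ::
    "(real \<Rightarrow> complex \<Rightarrow> complex) \<Rightarrow> (complex \<Rightarrow> complex) \<Rightarrow> real \<Rightarrow> bool" where
  "has_bf_derivative u D t \<longleftrightarrow>
     (\<forall>s. u s \<in> bargmann_fock) \<and> D \<in> bargmann_fock \<and>
     ((\<lambda>h. L2_norm (\<lambda>z. (u (t + h) z - u t z) / of_real h - D z)) \<longlongrightarrow> 0) (at 0)"

text \<open>\<open>U n\<close> is the \<open>n\<close>-th derivative of the curve. A curve in the product of two copies of the
  space is smooth iff both of its components are smooth.\<close>

definition bf_smooth :: "(real \<Rightarrow> complex \<Rightarrow> complex) \<Rightarrow> bool" where
  "bf_smooth u \<longleftrightarrow>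
     (\<exists>U. U 0 = u \<and> (\<forall>n t. has_bf_derivative (U n) (U (Suc n) t) t))"

definition solves_system ::
    "real \<Rightarrow> (complex \<Rightarrow> complex) \<Rightarrow> (complex \<Rightarrow> complex) \<Rightarrow>
     (real \<Rightarrow> complex \<Rightarrow> complex) \<Rightarrow> (real \<Rightarrow> complex \<Rightarrow> complex) \<Rightarrow> bool" where
  "solves_system \<sigma> u\<^sub>0 v\<^sub>0 u v \<longleftrightarrow>
     bf_smooth u \<and> bf_smooth v \<and> u 0 = u\<^sub>0 \<and> v 0 = v\<^sub>0 \<and>
     (\<forall>t. \<exists>du dv. has_bf_derivative u du t \<and> has_bf_derivative v dv t \<and>
        (\<forall>z. \<i> * du z = bf_proj (\<lambda>w. of_real ((cmod (v t w))\<^sup>2) * u t w) z) \<and>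
        (\<forall>z. \<i> * dv z = of_real \<sigma> * bf_proj (\<lambda>w. of_real ((cmod (u t w))\<^sup>2) * v t w) z))"

end

theory Submission
  imports Defs "HOL-Complex_Analysis.Cauchy_Integral_Formula" "HOL-Probability.Distributions"
begin

text \<open>
  Write \<open>E\<close> for the Bargmann-Fock space and \<open>H\<close> for the Hamiltonian. Every \<open>u\<close> in \<open>E\<close> satisfies
  Carlen's inequality \<open>\<bar>u z\<bar> \<le> \<parallel>u\<parallel> / sqrt \<pi>\<close> (\<open>bargmann_fock_pointwise_bound\<close>), where \<open>\<parallel>u\<parallel>\<close> is the
  \<open>L\<^sup>2\<close> norm. It also gives
  \<open>H u v \<le> \<parallel>u\<parallel>\<^sub>\<infinity> * (\<parallel>u\<parallel> / sqrt \<pi>) * \<parallel>v\<parallel>\<^sup>2\<close> (\<open>hamiltonian_le\<close>). Applied at time \<open>t\<close>, these are the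
  upper and the lower bounds, once \<open>\<parallel>u\<parallel>\<close>, \<open>\<parallel>v\<parallel>\<close> and \<open>H u v\<close> are known to be constant in time.

  Carlen's inequality is Cauchy-Schwarz applied to the reproducing property \<open>\<Pi> u = u\<close>
  (\<open>bf_proj_reproducing\<close>). The latter becomes, after a translation, the statement that the mean of an
  entire function against the Gaussian \<open>exp (- \<bar>z\<bar>\<^sup>2) / \<pi>\<close> is its value at the origin
  (\<open>gaussian_mean_value\<close>): averaging over rotations, which preserve Lebesgue measure and the Gaussian,
  reduces this to Cauchy's integral formula on circles.

  The conservation laws (\<open>conservation_laws\<close>) use that \<open>\<langle>\<Pi> g, \<phi>\<rangle> = \<langle>g, \<phi>\<rangle>\<close> for square integrable \<open>g\<close>
  and \<open>\<phi>\<close> in \<open>E\<close> (\<open>bf_proj_self_adjoint\<close>). The equation \<open>\<i> u' = \<Pi> (\<bar>v\<bar>\<^sup>2 u)\<close> then yields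
  \<open>\<i> \<langle>u', u\<rangle> = H u v\<close>, so \<open>Re \<langle>u', u\<rangle> = 0\<close>, and \<open>\<langle>\<bar>v\<bar>\<^sup>2 u, u'\<rangle> = \<i> \<langle>u', u'\<rangle>\<close>, which has real part \<open>0\<close>. The
  second equation gives the same with \<open>u\<close> and \<open>v\<close> exchanged, up to the factor \<open>\<sigma>\<close>, which is real and
  so leaves both real parts zero. Since formally the derivative of \<open>H u v\<close> is \<open>2 Re \<langle>\<bar>v\<bar>\<^sup>2 u, u'\<rangle> + 2 Re \<langle>\<bar>u\<bar>\<^sup>2 v, v'\<rangle>\<close>, all three quantities are
  conserved.

  The derivatives of \<open>u\<close> and \<open>v\<close> exist in the \<open>L\<^sup>2\<close> norm, while \<open>H\<close> is quartic. To differentiate it, note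
  that \<open>z \<mapsto> u (z / sqrt 2) * v (z / sqrt 2)\<close> lies in \<open>E\<close> again, depends on \<open>(u, v)\<close> as a bounded
  bilinear map, and has squared norm \<open>2 * H u v\<close>. The product rule in the inner product space \<open>E\<close> thus
  covers all three conservation laws.
\<close>

section \<open>Rotation invariance of Lebesgue measure on the complex plane\<close>

lemma borel_measurable_Complex [measurable]:
  assumes [measurable]: "f \<in> borel_measurable M" "g \<in> borel_measurable M"
  shows "(\<lambda>x. Complex (f x) (g x)) \<in> borel_measurable M"
  unfolding Complex_eq by measurable

lemma lborel_complex_eq_distr_pair:
  "(lborel :: complex measure) = distr (lborel \<Otimes>\<^sub>M lborel) borel (\<lambda>(x, y). Complex x y)"
proof (rule lborel_eqI)
  have [measurable]: "(\<lambda>(x, y). Complex x y) \<in> borel_measurable (lborel \<Otimes>\<^sub>M lborel)"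
    unfolding case_prod_beta by measurable
  fix l u :: complex
  assume lu: "\<And>b. b \<in> Basis \<Longrightarrow> l \<bullet> b \<le> u \<bullet> b"
  have "(\<lambda>(x, y). Complex x y) -` box l u = box (Re l) (Re u) \<times> box (Im l) (Im u)"
    by (auto simp: box_def Basis_complex_def)
  moreover have "Re l \<le> Re u" "Im l \<le> Im u"
    using lu[of 1] lu[of \<i>] by (auto simp: Basis_complex_def)
  ultimately show "emeasure (distr (lborel \<Otimes>\<^sub>M lborel) borel (\<lambda>(x, y). Complex x y)) (box l u)
      = ennreal (\<Prod>b\<in>Basis. (u - l) \<bullet> b)"
    by (subst emeasure_distr)
       (auto simp: borel_prod lborel.emeasure_pair_measure_Times Basis_complex_def ennreal_mult
         space_pair_measure)
qed simp

lemma nn_integral_lborel_complex: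
  fixes f :: "complex \<Rightarrow> ennreal"
  assumes [measurable]: "f \<in> borel_measurable borel"
  shows "(\<integral>\<^sup>+z. f z \<partial>lborel) = (\<integral>\<^sup>+x. \<integral>\<^sup>+y. f (Complex x y) \<partial>lborel \<partial>lborel)"
    and "(\<integral>\<^sup>+z. f z \<partial>lborel) = (\<integral>\<^sup>+y. \<integral>\<^sup>+x. f (Complex x y) \<partial>lborel \<partial>lborel)"
proof -
  have [measurable]: "(\<lambda>(x, y). Complex x y) \<in> borel_measurable (lborel \<Otimes>\<^sub>M lborel)"
    unfolding case_prod_beta by measurable
  have eq: "(\<integral>\<^sup>+z. f z \<partial>lborel) = (\<integral>\<^sup>+p. f (Complex (fst p) (snd p)) \<partial>(lborel \<Otimes>\<^sub>M lborel))"
    by (subst lborel_complex_eq_distr_pair, subst nn_integral_distr) (auto simp: case_prod_beta)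
  show "(\<integral>\<^sup>+z. f z \<partial>lborel) = (\<integral>\<^sup>+x. \<integral>\<^sup>+y. f (Complex x y) \<partial>lborel \<partial>lborel)"
    unfolding eq by (subst lborel.nn_integral_fst[symmetric]) simp_all
  show "(\<integral>\<^sup>+z. f z \<partial>lborel) = (\<integral>\<^sup>+y. \<integral>\<^sup>+x. f (Complex x y) \<partial>lborel \<partial>lborel)"
    unfolding eq by (subst lborel_pair.nn_integral_snd[symmetric]) simp_all
qed

lemma nn_integral_lborel_shift:
  fixes f :: "'a::euclidean_space \<Rightarrow> ennreal"
  assumes [measurable]: "f \<in> borel_measurable borel"
  shows "(\<integral>\<^sup>+x. f (x + a) \<partial>lborel) = (\<integral>\<^sup>+x. f x \<partial>lborel)"
  by (subst lborel_distr_plus[of a, symmetric], subst nn_integral_distr) (simp_all add: add.commute)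

text \<open>
  A shear translates every horizontal (or vertical) line within itself, so Tonelli's theorem reduces
  its invariance to translation invariance on the real line.
\<close>

lemma nn_integral_shear_Re:
  fixes f :: "complex \<Rightarrow> ennreal"
  assumes [measurable]: "f \<in> borel_measurable borel"
  shows "(\<integral>\<^sup>+z. f (z + of_real (a * Im z)) \<partial>lborel) = (\<integral>\<^sup>+z. f z \<partial>lborel)"
proof -
  have "(\<integral>\<^sup>+z. f (z + of_real (a * Im z)) \<partial>lborel)
      = (\<integral>\<^sup>+y. \<integral>\<^sup>+x. f (Complex (x + a * y) y) \<partial>lborel \<partial>lborel)"
    by (subst nn_integral_lborel_complex(2)) (auto simp: complex_eq_iff intro!: nn_integral_cong arg_cong[where f = f])
  also have "\<dots> = (\<integral>\<^sup>+y. \<integral>\<^sup>+x. f (Complex x y) \<partial>lborel \<partial>lborel)"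
    by (intro nn_integral_cong nn_integral_lborel_shift[where f = "\<lambda>x. f (Complex x _)"]) measurable
  also have "\<dots> = (\<integral>\<^sup>+z. f z \<partial>lborel)"
    by (subst nn_integral_lborel_complex(2)) auto
  finally show ?thesis .
qed

lemma nn_integral_shear_Im:
  fixes f :: "complex \<Rightarrow> ennreal"
  assumes [measurable]: "f \<in> borel_measurable borel"
  shows "(\<integral>\<^sup>+z. f (z + \<i> * of_real (a * Re z)) \<partial>lborel) = (\<integral>\<^sup>+z. f z \<partial>lborel)"
proof -
  have "(\<integral>\<^sup>+z. f (z + \<i> * of_real (a * Re z)) \<partial>lborel)
      = (\<integral>\<^sup>+x. \<integral>\<^sup>+y. f (Complex x (y + a * x)) \<partial>lborel \<partial>lborel)"
    by (subst nn_integral_lborel_complex(1)) (auto simp: complex_eq_iff intro!: nn_integral_cong arg_cong[where f = f])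
  also have "\<dots> = (\<integral>\<^sup>+x. \<integral>\<^sup>+y. f (Complex x y) \<partial>lborel \<partial>lborel)"
    by (intro nn_integral_cong nn_integral_lborel_shift[where f = "\<lambda>y. f (Complex _ y)"]) measurable
  also have "\<dots> = (\<integral>\<^sup>+z. f z \<partial>lborel)"
    by (subst nn_integral_lborel_complex(1)) auto
  finally show ?thesis .
qed

text \<open>
  A rotation other than the half turn is a product of three shears: horizontal, vertical, and the
  same horizontal one again. The half turn is the square of the rotation by \<open>\<i>\<close>.
\<close>

lemma nn_integral_rotate:
  fixes f :: "complex \<Rightarrow> ennreal"
  assumes f: "f \<in> borel_measurable borel" and c: "cmod c = 1"
  shows "(\<integral>\<^sup>+z. f (c * z) \<partial>lborel) = (\<integral>\<^sup>+z. f z \<partial>lborel)"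
proof -
  have main: "(\<integral>\<^sup>+z. f (c * z) \<partial>lborel) = (\<integral>\<^sup>+z. f z \<partial>lborel)"
    if c: "cmod c = 1" "c \<noteq> -1" and [measurable]: "f \<in> borel_measurable borel" for c f
  proof -
    have sq: "(Re c)\<^sup>2 + (Im c)\<^sup>2 = 1" using c by (simp add: cmod_def)
    have ne: "1 + Re c \<noteq> 0"
    proof
      assume "1 + Re c = 0"
      then have "Re c = -1" by simp
      with sq have "c = -1" by (simp add: complex_eq_iff)
      with c show False by simp
    qed
    \<comment> \<open>For \<open>c = exp (\<i>\<theta>)\<close> this is \<open>- tan (\<theta> / 2)\<close>.\<close>
    define a where "a = - Im c / (1 + Re c)"
    define S where "S = (\<lambda>z. z + of_real (a * Im z))"
    define T where "T = (\<lambda>z. z + \<i> * of_real (Im c * Re z))"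
    have [measurable]: "S \<in> borel_measurable borel" "T \<in> borel_measurable borel"
      unfolding S_def T_def by (intro borel_measurable_continuous_onI continuous_intros)+
    have 1: "1 + a * Im c = Re c"
    proof -
      have "a * Im c * (1 + Re c) = - (Im c)\<^sup>2" using ne by (simp add: a_def power2_eq_square)
      also have "\<dots> = (Re c - 1) * (1 + Re c)" using sq by (simp add: power2_eq_square algebra_simps)
      finally show ?thesis using ne by simp
    qed
    have 2: "a * (1 + Re c) = - Im c" using ne by (simp add: a_def)
    have "c * z = S (T (S z))" for z
    proof (rule complex_eqI)
      have "Re (S (T (S z))) = (1 + a * Im c) * Re z + a * (1 + (1 + a * Im c)) * Im z"
        by (simp add: S_def T_def algebra_simps)
      then show "Re (c * z) = Re (S (T (S z)))" unfolding 1 2 by simp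
      have "Im (S (T (S z))) = Im c * Re z + (1 + a * Im c) * Im z"
        by (simp add: S_def T_def algebra_simps)
      then show "Im (c * z) = Im (S (T (S z)))" unfolding 1 by simp
    qed
    then have "(\<integral>\<^sup>+z. f (c * z) \<partial>lborel) = (\<integral>\<^sup>+z. f (S (T (S z))) \<partial>lborel)" by simp
    also have "\<dots> = (\<integral>\<^sup>+z. f (S (T z)) \<partial>lborel)"
      using nn_integral_shear_Re[of "\<lambda>z. f (S (T z))" a] by (simp add: S_def)
    also have "\<dots> = (\<integral>\<^sup>+z. f (S z) \<partial>lborel)"
      using nn_integral_shear_Im[of "\<lambda>z. f (S z)" "Im c"] by (simp add: T_def)
    also have "\<dots> = (\<integral>\<^sup>+z. f z \<partial>lborel)"
      using nn_integral_shear_Re[of f a] by (simp add: S_def)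
    finally show ?thesis .
  qed
  show ?thesis
  proof (cases "c = -1")
    case True
    have [measurable]: "f \<in> borel_measurable borel" by fact
    have "(\<integral>\<^sup>+z. f (c * z) \<partial>lborel) = (\<integral>\<^sup>+z. f (\<i> * (\<i> * z)) \<partial>lborel)"
      using True by (simp flip: mult.assoc)
    also have "\<dots> = (\<integral>\<^sup>+z. f (\<i> * z) \<partial>lborel)"
      by (rule main[of \<i> "\<lambda>z. f (\<i> * z)"]) (auto simp: complex_eq_iff)
    also have "\<dots> = (\<integral>\<^sup>+z. f z \<partial>lborel)"
      by (rule main[of \<i> f]) (auto simp: complex_eq_iff)
    finally show ?thesis .
  qed (use main c f in auto)
qed

lemma lborel_distr_rotate:
  assumes "cmod c = 1"
  shows "distr lborel borel ((*) c) = (lborel :: complex measure)"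
proof (rule measure_eqI)
  fix A assume "A \<in> sets (distr lborel borel ((*) c))"
  then have [measurable]: "A \<in> sets borel" by simp
  have "emeasure (distr lborel borel ((*) c)) A = (\<integral>\<^sup>+z. indicator A (c * z) \<partial>lborel)"
    by (subst nn_integral_indicator[symmetric], simp, subst nn_integral_distr) auto
  also have "\<dots> = emeasure lborel A"
    using assms by (subst nn_integral_rotate) simp_all
  finally show "emeasure (distr lborel borel ((*) c)) A = emeasure lborel A" .
qed simp

lemma integral_rotate:
  fixes f :: "complex \<Rightarrow> 'b::{banach, second_countable_topology}"
  assumes "cmod c = 1" and [measurable]: "f \<in> borel_measurable borel"
  shows "(LINT z|lborel. f (c * z)) = (LINT z|lborel. f z)"
    and "integrable lborel (\<lambda>z. f (c * z)) \<longleftrightarrow> integrable lborel f"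
proof -
  show "(LINT z|lborel. f (c * z)) = (LINT z|lborel. f z)"
    by (subst lborel_distr_rotate[OF assms(1), symmetric], subst integral_distr) simp_all
  show "integrable lborel (\<lambda>z. f (c * z)) \<longleftrightarrow> integrable lborel f"
    by (subst (2) lborel_distr_rotate[OF assms(1), symmetric], subst integrable_distr_eq) simp_all
qed

lemma integral_lborel_shift:
  fixes f :: "'a::euclidean_space \<Rightarrow> 'b::{banach, second_countable_topology}"
  assumes [measurable]: "f \<in> borel_measurable borel"
  shows "(LINT x|lborel. f (a + x)) = (LINT x|lborel. f x)"
    and "integrable lborel (\<lambda>x. f (a + x)) \<longleftrightarrow> integrable lborel f"
proof -
  show "(LINT x|lborel. f (a + x)) = (LINT x|lborel. f x)"
    by (subst lborel_distr_plus[of a, symmetric], subst integral_distr) simp_all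
  show "integrable lborel (\<lambda>x. f (a + x)) \<longleftrightarrow> integrable lborel f"
    by (subst (2) lborel_distr_plus[of a, symmetric], subst integrable_distr_eq) simp_all
qed

lemma integral_dilate_complex:
  fixes f :: "complex \<Rightarrow> 'b::{banach, second_countable_topology}"
  assumes "a \<noteq> 0" and [measurable]: "f \<in> borel_measurable borel"
  shows "(LINT z|lborel. f (z /\<^sub>R a)) = a\<^sup>2 *\<^sub>R (LINT z|lborel. f z)"
    and "integrable lborel f \<Longrightarrow> integrable lborel (\<lambda>z. f (z /\<^sub>R a))"
proof -
  have eq: "lborel = density (distr lborel borel (\<lambda>x::complex. a *\<^sub>R x)) (\<lambda>_. ennreal (a\<^sup>2))"
    using lborel_affine[OF assms(1), of "0::complex"] by simp
  have m[measurable]: "(\<lambda>z. f (z /\<^sub>R a)) \<in> borel_measurable borel" by measurable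
  show "(LINT z|lborel. f (z /\<^sub>R a)) = a\<^sup>2 *\<^sub>R (LINT z|lborel. f z)"
    using assms(1) by (subst eq, subst integral_density) (auto simp: integral_distr)
  show "integrable lborel f \<Longrightarrow> integrable lborel (\<lambda>z. f (z /\<^sub>R a))"
    using assms(1) by (subst eq, subst integrable_density) (auto simp: integrable_distr_eq)
qed

section \<open>The Gaussian mean value property of entire functions\<close>

lemma has_integral_circle_mean:
  assumes "f holomorphic_on UNIV"
  shows "((\<lambda>t. f (z * exp (2 * of_real pi * \<i> * of_real t))) has_integral f 0) {0..1::real}"
proof -
  have "(\<lambda>w. f (z * w)) holomorphic_on cball 0 1"
    by (rule holomorphic_on_compose_gen[OF _ assms, unfolded o_def]) (auto intro!: holomorphic_intros)
  then have "((\<lambda>w. f (z * w) / (w - 0)) has_contour_integral (2 * of_real pi * \<i> * f (z * 0))) (circlepath 0 1)"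
    by (rule Cauchy_integral_circlepath_simple) simp
  then have "((\<lambda>t. 2 * of_real pi * \<i> * f (z * exp (2 * of_real pi * \<i> * of_real t))) has_integral (2 * of_real pi * \<i> * f (z * 0))) {0..1::real}"
    unfolding has_contour_integral_def
    by (rule has_integral_eq[rotated])
       (simp add: vector_derivative_circlepath01, simp add: circlepath field_simps)
  from has_integral_mult_right[OF this, of "1 / (2 * of_real pi * \<i>)"] show ?thesis
    by simp
qed

lemma lebesgue_integral_circle_mean:
  assumes "f holomorphic_on UNIV"
  shows "(LINT t:{0..1::real}|lborel. f (z * exp (2 * of_real pi * \<i> * of_real t))) = f 0"
proof -
  have "continuous_on UNIV f" using assms by (rule holomorphic_on_imp_continuous_on)
  then have "continuous_on {0..1::real} (\<lambda>t. f (z * exp (2 * of_real pi * \<i> * of_real t)))"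
    by (rule continuous_on_compose2) (auto intro!: continuous_intros)
  then have "set_integrable lborel {0..1::real} (\<lambda>t. f (z * exp (2 * of_real pi * \<i> * of_real t)))"
    by (rule borel_integrable_atLeastAtMost')
  then have "(LINT t:{0..1::real}|lborel. f (z * exp (2 * of_real pi * \<i> * of_real t)))
     = integral {0..1} (\<lambda>t. f (z * exp (2 * of_real pi * \<i> * of_real t)))"
    by (rule set_borel_integral_eq_integral)
  then show ?thesis using has_integral_circle_mean[OF assms] by (simp add: integral_unique)
qed

text \<open>
  The integrand is a multiple of the centred normal density with variance \<open>1 / (2 * c)\<close>, whose total
  mass is \<open>1\<close>.
\<close>

lemma has_bochner_integral_gaussian_real:
  assumes "c > 0"
  shows "has_bochner_integral lborel (\<lambda>x::real. exp (- c * x\<^sup>2)) (sqrt (pi / c))"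
proof -
  define s where "s = sqrt (1 / (2 * c))"
  have s: "s > 0" "s\<^sup>2 = 1 / (2 * c)" using assms by (auto simp: s_def)
  have "has_bochner_integral lborel (\<lambda>x. normal_density 0 s x * sqrt (2 * pi * s\<^sup>2)) (1 * sqrt (2 * pi * s\<^sup>2))"
    using s by (intro has_bochner_integral_mult_left) (auto simp: has_bochner_integral_iff)
  moreover have "normal_density 0 s x * sqrt (2 * pi * s\<^sup>2) = exp (- c * x\<^sup>2)" for x
    using s assms by (simp add: normal_density_def field_simps)
  ultimately show ?thesis using s assms by (simp add: field_simps)
qed

lemma has_bochner_integral_gaussian_complex:
  assumes c: "c > 0"
  shows "has_bochner_integral lborel (\<lambda>z::complex. exp (- c * (cmod z)\<^sup>2)) (pi / c)"
proof (rule has_bochner_integral_nn_integral)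
  have 1: "(\<integral>\<^sup>+x. ennreal (exp (- c * x\<^sup>2)) \<partial>lborel) = ennreal (sqrt (pi / c))" (is "?I = _")
    using has_bochner_integral_gaussian_real[OF c]
    by (subst nn_integral_eq_integral) (auto simp: has_bochner_integral_iff)
  have split: "ennreal (exp (- c * (cmod z)\<^sup>2)) = (\<Prod>b\<in>Basis. ennreal (exp (- c * (z \<bullet> b)\<^sup>2)))" for z
  proof -
    have "exp (- c * (cmod z)\<^sup>2) = exp (- c * (Re z)\<^sup>2) * exp (- c * (Im z)\<^sup>2)"
      unfolding cmod_power2 exp_add[symmetric] distrib_left ..
    then show ?thesis by (simp only: ennreal_mult exp_ge_zero) (simp add: Basis_complex_def)
  qed
  have "(\<integral>\<^sup>+z. ennreal (exp (- c * (cmod z)\<^sup>2)) \<partial>lborel)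
      = (\<integral>\<^sup>+z. (\<Prod>b\<in>(Basis::complex set). ennreal (exp (- c * (z \<bullet> b)\<^sup>2))) \<partial>lborel)"
    by (simp only: split)
  also have "\<dots> = (\<Prod>b\<in>(Basis::complex set). ?I)"
    by (rule nn_integral_lborel_prod) auto
  also have "\<dots> = ennreal (pi / c)"
    unfolding 1 prod_constant using c by (subst ennreal_power) auto
  finally show "(\<integral>\<^sup>+z. ennreal (exp (- c * (cmod z)\<^sup>2)) \<partial>lborel) = ennreal (pi / c)" .
  show "0 \<le> pi / c" using c by simp
qed auto

text \<open>
  The Gaussian weight is radial, so the integral does not change when \<open>F\<close> is replaced by its
  composition with a rotation, and hence when \<open>F\<close> is replaced by its average over all rotations.
  By Cauchy's integral formula on circles that average is the constant \<open>F 0\<close>. The average and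
  the area integral may be exchanged because the integral of \<open>\<bar>g (e t * z)\<bar>\<close> over \<open>z\<close> is the same
  for every \<open>t\<close>.
\<close>

lemma gaussian_mean_value:
  assumes F: "F holomorphic_on UNIV"
    and int: "integrable lborel (\<lambda>z. of_real (exp (- (cmod z)\<^sup>2)) * F z)"
  shows "(LINT z|lborel. of_real (exp (- (cmod z)\<^sup>2)) * F z) = of_real pi * F 0"
proof -
  define e where "e t = exp (2 * of_real pi * \<i> * of_real t)" for t :: real
  define g where "g z = of_real (exp (- (cmod z)\<^sup>2)) * F z" for z
  have cF: "continuous_on UNIV F" using F by (rule holomorphic_on_imp_continuous_on)
  then have cg: "continuous_on UNIV g" unfolding g_def by (intro continuous_intros)
  then have [measurable]: "g \<in> borel_measurable borel" by (rule borel_measurable_continuous_onI)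
  have ce: "continuous_on UNIV e" unfolding e_def by (intro continuous_intros)
  have [measurable]: "e \<in> borel_measurable borel" using ce by (rule borel_measurable_continuous_onI)
  have e1: "cmod (e t) = 1" for t unfolding e_def by (simp add: norm_exp)
  define h where "h t z = indicator {0..1::real} t *\<^sub>R g (e t * z)" for t z
  have [measurable]: "case_prod h \<in> borel_measurable (lborel \<Otimes>\<^sub>M lborel)" unfolding h_def by measurable
  have intg: "integrable lborel (\<lambda>z. g (e t * z))" for t
    using int unfolding integral_rotate(2)[OF e1 \<open>g \<in> borel_measurable borel\<close>] by (simp add: g_def[abs_def])
  have "integrable (lborel \<Otimes>\<^sub>M lborel) (case_prod h)"
  proof (rule lborel_pair.Fubini_integrable)
    have "(LINT z|lborel. norm (h t z)) = indicator {0..1} t *\<^sub>R (LINT z|lborel. norm (g z))" for t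
    proof -
      have "(LINT z|lborel. norm (h t z)) = (LINT z|lborel. indicator {0..1} t *\<^sub>R norm (g (e t * z)))"
        by (simp add: h_def)
      also have "\<dots> = indicator {0..1} t *\<^sub>R (LINT z|lborel. norm (g (e t * z)))" by simp
      also have "(LINT z|lborel. norm (g (e t * z))) = (LINT z|lborel. norm (g z))"
        by (rule integral_rotate(1)[OF e1, of "\<lambda>z. norm (g z)"]) measurable
      finally show ?thesis .
    qed
    then show "integrable lborel (\<lambda>t. LINT z|lborel. norm (case_prod h (t, z)))"
      by (simp add: integrable_indicator_iff)
    show "AE t in lborel. integrable lborel (\<lambda>z. case_prod h (t, z))"
      using intg by (intro AE_I2) (simp add: h_def)
  qed fact
  then have swap: "(LINT z|lborel. (LINT t|lborel. h t z)) = (LINT t|lborel. (LINT z|lborel. h t z))"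
    by (rule lborel_pair.Fubini_integral)
  have inner: "(LINT t|lborel. h t z) = of_real (exp (- (cmod z)\<^sup>2)) * F 0" for z
  proof -
    have "h t z = of_real (exp (- (cmod z)\<^sup>2)) * (indicator {0..1} t *\<^sub>R F (z * e t))" for t
      by (simp add: h_def g_def norm_mult e1 mult.commute)
    then have "(LINT t|lborel. h t z) = of_real (exp (- (cmod z)\<^sup>2)) * (LINT t:{0..1}|lborel. F (z * e t))"
      unfolding set_lebesgue_integral_def by (simp only: integral_mult_right_zero)
    then show ?thesis using lebesgue_integral_circle_mean[OF F, of z] by (simp add: e_def)
  qed
  have outer: "(LINT z|lborel. h t z) = indicator {0..1} t *\<^sub>R (LINT z|lborel. g z)" for t
    using integral_rotate(1)[OF e1[of t], of g] by (simp add: h_def)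
  have "(LINT z|lborel. complex_of_real (exp (- (cmod z)\<^sup>2)) * F 0) = of_real pi * F 0"
    using has_bochner_integral_gaussian_complex[of 1] 
    by (simp add: has_bochner_integral_iff)
  with swap show ?thesis unfolding inner outer by (simp flip: g_def)
qed

section \<open>The reproducing kernel of the Bargmann-Fock space\<close>

lemma cmod_mult_le_sum_squares: "cmod (x * y) \<le> (cmod x)\<^sup>2 + (cmod y)\<^sup>2"
proof -
  have "0 \<le> (cmod x - cmod y)\<^sup>2 + ((cmod x)\<^sup>2 + (cmod y)\<^sup>2)" by simp
  then show ?thesis by (simp add: norm_mult power2_diff)
qed

lemma L2_D [measurable_dest]: "u \<in> L2 \<Longrightarrow> u \<in> borel_measurable borel"
  by (simp add: L2_def)

lemma L2_integrable_square: "u \<in> L2 \<Longrightarrow> integrable lborel (\<lambda>z. (cmod (u z))\<^sup>2)"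
  by (simp add: L2_def)

lemma L2_integrable_mult:
  assumes "f \<in> L2" "g \<in> L2"
  shows "integrable lborel (\<lambda>z. f z * g z)"
proof (rule Bochner_Integration.integrable_bound)
  show "integrable lborel (\<lambda>z. (cmod (f z))\<^sup>2 + (cmod (g z))\<^sup>2)"
    using assms by (intro Bochner_Integration.integrable_add L2_integrable_square)
  show "(\<lambda>z. f z * g z) \<in> borel_measurable lborel"
    using assms[THEN L2_D] by simp
qed (use cmod_mult_le_sum_squares in auto)

lemma borel_measurable_cnj [measurable]:
  "f \<in> borel_measurable M \<Longrightarrow> (\<lambda>x. cnj (f x)) \<in> borel_measurable M"
  by (rule borel_measurable_continuous_on[where f = cnj]) (auto intro: continuous_intros)

lemma L2_cnj: "f \<in> L2 \<Longrightarrow> (\<lambda>z. cnj (f z)) \<in> L2"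
  by (auto simp: L2_def intro: borel_measurable_cnj)

lemma L2_cmult:
  assumes "f \<in> L2"
  shows "(\<lambda>z. c * f z) \<in> L2"
  using assms by (auto simp: L2_def norm_mult power_mult_distrib)

lemma L2_bounded_mult:
  assumes f: "f \<in> L2" and [measurable]: "g \<in> borel_measurable borel"
    and bound: "\<And>z. cmod (g z) \<le> B"
  shows "(\<lambda>z. g z * f z) \<in> L2"
proof -
  have [measurable]: "f \<in> borel_measurable borel" using f by (rule L2_D)
  have "integrable lborel (\<lambda>z. (cmod (g z * f z))\<^sup>2)"
  proof (rule Bochner_Integration.integrable_bound)
    show "integrable lborel (\<lambda>z. B\<^sup>2 * (cmod (f z))\<^sup>2)"
      using f by (intro integrable_mult_right L2_integrable_square)
    show "AE z in lborel. norm ((cmod (g z * f z))\<^sup>2) \<le> norm (B\<^sup>2 * (cmod (f z))\<^sup>2)"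
      using bound by (auto simp: norm_mult power_mult_distrib intro!: mult_right_mono power_mono)
  qed simp
  then show ?thesis by (simp add: L2_def)
qed

lemma bargmann_fockE:
  assumes "u \<in> bargmann_fock"
  obtains f where "f holomorphic_on UNIV" "u = (\<lambda>z. of_real (exp (- (cmod z)\<^sup>2 / 2)) * f z)"
  using assms by (auto simp: bargmann_fock_def)

lemma bargmann_fock_L2: "u \<in> bargmann_fock \<Longrightarrow> u \<in> L2"
  by (simp add: bargmann_fock_def)

lemma bargmann_fockI:
  "f holomorphic_on UNIV \<Longrightarrow> u = (\<lambda>z. of_real (exp (- (cmod z)\<^sup>2 / 2)) * f z) \<Longrightarrow> u \<in> L2
    \<Longrightarrow> u \<in> bargmann_fock"
  by (auto simp: bargmann_fock_def)

text \<open>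
  The integral kernel of the projection with both Gaussian weights included. In this form it is
  Hermitian, and its modulus depends only on the difference of the two points.
\<close>

definition fock_kernel :: "complex \<Rightarrow> complex \<Rightarrow> complex" where
  "fock_kernel z w = exp (cnj w * z - of_real ((cmod w)\<^sup>2 / 2) - of_real ((cmod z)\<^sup>2 / 2)) / of_real pi"

lemma bf_proj_eq_kernel: "bf_proj u z = (LINT w|lborel. fock_kernel z w * u w)"
proof -
  have "fock_kernel z w = exp (of_real (- (cmod z)\<^sup>2 / 2)) *
      exp (cnj w * z - of_real ((cmod w)\<^sup>2 / 2)) / of_real pi" for w
    unfolding fock_kernel_def exp_add[symmetric] by (simp add: algebra_simps)
  then have "fock_kernel z w * u w = of_real (1 / pi * exp (- (cmod z)\<^sup>2 / 2)) *
      (exp (cnj w * z - of_real ((cmod w)\<^sup>2 / 2)) * u w)" for w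
    unfolding exp_of_real by simp
  then show ?thesis by (simp add: bf_proj_def)
qed

lemma cnj_fock_kernel: "cnj (fock_kernel z w) = fock_kernel w z"
  by (simp add: fock_kernel_def exp_cnj algebra_simps)

lemma cmod_diff_power2: "(cmod (z - w))\<^sup>2 = (cmod z)\<^sup>2 + (cmod w)\<^sup>2 - 2 * Re (cnj w * z)"
  unfolding cmod_power2 by (simp add: power2_eq_square algebra_simps)

lemma cmod_fock_kernel: "cmod (fock_kernel z w) = exp (- (cmod (z - w))\<^sup>2 / 2) / pi"
  unfolding fock_kernel_def norm_divide norm_exp_eq_Re cmod_diff_power2
  by (simp add: field_simps)

lemma borel_measurable_fock_kernel [measurable]:
  assumes [measurable]: "f \<in> borel_measurable M" "g \<in> borel_measurable M"
  shows "(\<lambda>x. fock_kernel (f x) (g x)) \<in> borel_measurable M"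
  unfolding fock_kernel_def by measurable

lemma has_bochner_integral_fock_kernel_square:
  "has_bochner_integral lborel (\<lambda>w. (cmod (fock_kernel z w))\<^sup>2) (1 / pi)"
proof -
  have eq: "(cmod (fock_kernel z (z + w)))\<^sup>2 = exp (- 1 * (cmod w)\<^sup>2) / pi\<^sup>2" for w
    by (simp add: cmod_fock_kernel power_divide flip: exp_double)
  have "has_bochner_integral lborel (\<lambda>w. (cmod (fock_kernel z (z + w)))\<^sup>2) (pi / 1 / pi\<^sup>2)"
    unfolding eq by (intro has_bochner_integral_divide_zero has_bochner_integral_gaussian_complex) auto
  moreover have [measurable]: "(\<lambda>w. (cmod (fock_kernel z w))\<^sup>2) \<in> borel_measurable borel" by measurable
  ultimately show ?thesis
    using integral_lborel_shift[of "\<lambda>w. (cmod (fock_kernel z w))\<^sup>2" z]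
    by (auto simp: has_bochner_integral_iff power2_eq_square)
qed

lemma fock_kernel_L2: "fock_kernel z \<in> L2"
  using has_bochner_integral_fock_kernel_square[of z] by (simp add: L2_def has_bochner_integral_iff)

text \<open>
  Substituting \<open>w = z + \<zeta>\<close> completes the square: the integrand becomes
  \<open>exp (- \<bar>\<zeta>\<bar>\<^sup>2)\<close> times the entire function
  \<open>\<zeta> \<mapsto> exp (- \<bar>z\<bar>\<^sup>2 / 2 - cnj z * \<zeta>) * f (z + \<zeta>) / \<pi>\<close>, whose value at the origin is
  \<open>u z / \<pi>\<close>. The Gaussian mean value property then gives the claim.
\<close>

lemma bf_proj_reproducing:
  assumes "u \<in> bargmann_fock"
  shows "bf_proj u z = u z"
proof -
  obtain f where f: "f holomorphic_on UNIV" and u: "u = (\<lambda>z. of_real (exp (- (cmod z)\<^sup>2 / 2)) * f z)"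
    using assms by (rule bargmann_fockE)
  define F where "F \<zeta> = exp (- of_real ((cmod z)\<^sup>2 / 2) - cnj z * \<zeta>) * f (z + \<zeta>) / of_real pi" for \<zeta>
  have "(\<lambda>\<zeta>. f (z + \<zeta>)) holomorphic_on UNIV"
    by (rule holomorphic_on_compose_gen[OF _ f, unfolded o_def]) (auto intro!: holomorphic_intros)
  then have F: "F holomorphic_on UNIV"
    unfolding F_def by (intro holomorphic_intros) auto
  have eq: "fock_kernel z (z + \<zeta>) * u (z + \<zeta>) = of_real (exp (- (cmod \<zeta>)\<^sup>2)) * F \<zeta>" for \<zeta>
  proof -
    have "of_real ((cmod (z + \<zeta>))\<^sup>2) = of_real ((cmod z)\<^sup>2) + of_real ((cmod \<zeta>)\<^sup>2) + cnj z * \<zeta> + z * cnj \<zeta>"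
      unfolding complex_norm_square by (simp add: algebra_simps)
    moreover have "of_real ((cmod z)\<^sup>2) = z * cnj z" by (rule complex_norm_square)
    ultimately have "cnj (z + \<zeta>) * z - of_real ((cmod (z + \<zeta>))\<^sup>2 / 2) - of_real ((cmod z)\<^sup>2 / 2)
        + of_real (- (cmod (z + \<zeta>))\<^sup>2 / 2)
      = of_real (- (cmod \<zeta>)\<^sup>2) + (- of_real ((cmod z)\<^sup>2 / 2) - cnj z * \<zeta>)"
      by (simp add: field_simps)
    then show ?thesis
      unfolding fock_kernel_def u F_def exp_of_real[symmetric]
      by (simp only: times_divide_eq_left times_divide_eq_right mult.assoc[symmetric] exp_add[symmetric])
  qed
  have m: "(\<lambda>w. fock_kernel z w * u w) \<in> borel_measurable borel"
    using bargmann_fock_L2[OF assms, THEN L2_D] by measurable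
  have "integrable lborel (\<lambda>w. fock_kernel z w * u w)"
    by (intro L2_integrable_mult fock_kernel_L2 bargmann_fock_L2 assms)
  then have int: "integrable lborel (\<lambda>\<zeta>. of_real (exp (- (cmod \<zeta>)\<^sup>2)) * F \<zeta>)"
    using integral_lborel_shift(2)[OF m, of z] unfolding eq by simp
  have "bf_proj u z = (LINT \<zeta>|lborel. of_real (exp (- (cmod \<zeta>)\<^sup>2)) * F \<zeta>)"
    unfolding bf_proj_eq_kernel integral_lborel_shift(1)[OF m, of z, symmetric] eq ..
  also have "\<dots> = of_real pi * F 0"
    by (rule gaussian_mean_value[OF F int])
  also have "\<dots> = u z"
    by (simp add: F_def u exp_of_real[symmetric])
  finally show ?thesis .
qed

text \<open>
  Carlen's inequality: the reproducing property and the Cauchy-Schwarz inequality, because the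
  kernel \<open>fock_kernel z\<close> has squared \<open>L\<^sup>2\<close> norm \<open>1 / \<pi>\<close>.
\<close>

lemma bargmann_fock_pointwise_bound:
  assumes "u \<in> bargmann_fock"
  shows "cmod (u z) \<le> L2_norm u / sqrt pi"
proof -
  note L2 = bargmann_fock_L2[OF assms]
  define S where "S = (L2_norm u)\<^sup>2"
  have S: "S = (LINT w|lborel. (cmod (u w))\<^sup>2)" by (simp add: S_def L2_norm_def)
  have int: "integrable lborel (\<lambda>w. fock_kernel z w * u w)"
    by (intro L2_integrable_mult fock_kernel_L2 L2)
  \<comment> \<open>Cauchy-Schwarz in its arithmetic-geometric form; the optimal \<open>l\<close> is \<open>sqrt \<pi> * L2_norm u\<close>,
    and in the degenerate case \<open>L2_norm u = 0\<close> one lets \<open>l\<close> tend to \<open>0\<close>.\<close>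
  have main: "cmod (u z) \<le> (l / pi + S / l) / 2" if "l > 0" for l
  proof -
    have ptw: "cmod (fock_kernel z w * u w) \<le> (l * (cmod (fock_kernel z w))\<^sup>2 + (cmod (u w))\<^sup>2 / l) / 2" for w
    proof -
      have "0 \<le> (l * cmod (fock_kernel z w) - cmod (u w))\<^sup>2" by simp
      then show ?thesis using that by (simp add: norm_mult power2_eq_square field_simps)
    qed
    have K: "integrable lborel (\<lambda>w. (cmod (fock_kernel z w))\<^sup>2)"
        "(LINT w|lborel. (cmod (fock_kernel z w))\<^sup>2) = 1 / pi"
      using has_bochner_integral_fock_kernel_square[of z] by (auto simp: has_bochner_integral_iff)
    have "cmod (u z) = cmod (LINT w|lborel. fock_kernel z w * u w)"
      using bf_proj_reproducing[OF assms, of z] by (simp add: bf_proj_eq_kernel)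
    also have "\<dots> \<le> (LINT w|lborel. cmod (fock_kernel z w * u w))"
      by (rule integral_norm_bound)
    also have "\<dots> \<le> (LINT w|lborel. (l * (cmod (fock_kernel z w))\<^sup>2 + (cmod (u w))\<^sup>2 / l) / 2)"
      using int K(1) L2_integrable_square[OF L2] ptw by (intro integral_mono) auto
    also have "\<dots> = (l / pi + S / l) / 2"
      using K L2_integrable_square[OF L2] by (simp add: S)
    finally show ?thesis .
  qed
  show ?thesis
  proof (cases "L2_norm u = 0")
    case True
    have "cmod (u z) \<le> 0"
    proof (rule field_le_epsilon)
      fix e :: real assume "e > 0"
      then show "cmod (u z) \<le> 0 + e" using main[of "2 * pi * e"] True by (simp add: S_def)
    qed
    then show ?thesis using True by simp
  next
    case False
    then have pos: "L2_norm u > 0" by (simp add: L2_norm_def less_le)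
    have "cmod (u z) \<le> (sqrt pi * L2_norm u / pi + S / (sqrt pi * L2_norm u)) / 2"
      using pos by (intro main) simp
    also have "sqrt pi * L2_norm u / pi = L2_norm u / sqrt pi"
      by (simp add: field_simps)
    also have "S / (sqrt pi * L2_norm u) = L2_norm u / sqrt pi"
      using pos by (simp add: S_def field_simps power2_eq_square)
    finally show ?thesis by simp
  qed
qed

text \<open>
  The Schur test for the kernel: its modulus has the same finite integral, namely \<open>2\<close>, over every
  fibre. This makes the double integrals below absolutely convergent.
\<close>

lemma integrable_gaussian_convolution:
  fixes h :: "complex \<Rightarrow> real"
  assumes h: "integrable lborel h"
  shows "integrable (lborel \<Otimes>\<^sub>M lborel) (\<lambda>(z, w). cmod (fock_kernel z w) * h z)"
proof (rule lborel_pair.Fubini_integrable)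
  have [measurable]: "h \<in> borel_measurable borel" using h by simp
  show "(\<lambda>(z, w). cmod (fock_kernel z w) * h z) \<in> borel_measurable (lborel \<Otimes>\<^sub>M lborel)"
    by measurable
  have K: "integrable lborel (\<lambda>w. cmod (fock_kernel z w))" 
    "(LINT w|lborel. cmod (fock_kernel z w)) = 2" for z
  proof -
    have eq: "cmod (fock_kernel z (z + w)) = exp (- (1/2) * (cmod w)\<^sup>2) / pi" for w
      by (simp add: cmod_fock_kernel)
    have "has_bochner_integral lborel (\<lambda>w. cmod (fock_kernel z (z + w))) (pi / (1/2) / pi)"
      unfolding eq by (intro has_bochner_integral_divide_zero has_bochner_integral_gaussian_complex) auto
    then show "integrable lborel (\<lambda>w. cmod (fock_kernel z w))"
      "(LINT w|lborel. cmod (fock_kernel z w)) = 2"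
      using integral_lborel_shift[of "\<lambda>w. cmod (fock_kernel z w)" z]
      by (auto simp: has_bochner_integral_iff)
  qed
  show "AE z in lborel. integrable lborel (\<lambda>w. case (z, w) of (z, w) \<Rightarrow> cmod (fock_kernel z w) * h z)"
    using K(1) by simp
  have "(LINT w|lborel. norm (case (z, w) of (z, w) \<Rightarrow> cmod (fock_kernel z w) * h z)) = 2 * norm (h z)" for z
    using K(2)[of z] by (simp add: abs_mult)
  then show "integrable lborel (\<lambda>z. LINT w|lborel. norm (case (z, w) of (z, w) \<Rightarrow> cmod (fock_kernel z w) * h z))"
    using h by simp
qed

text \<open>
  The kernel is Hermitian, so after exchanging the integrals the projection falls on \<open>\<phi>\<close>, which it
  reproduces. Absolute convergence follows from the Schur test, since
  \<open>\<bar>g w * \<phi> z\<bar> \<le> \<bar>\<phi> z\<bar>\<^sup>2 + \<bar>g w\<bar>\<^sup>2\<close>.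
\<close>

lemma bf_proj_self_adjoint:
  assumes g: "g \<in> L2" and \<phi>: "\<phi> \<in> bargmann_fock"
  shows "(LINT z|lborel. bf_proj g z * cnj (\<phi> z)) = (LINT z|lborel. g z * cnj (\<phi> z))"
proof -
  have [measurable]: "g \<in> borel_measurable borel" "\<phi> \<in> borel_measurable borel"
    using g bargmann_fock_L2[OF \<phi>] by (auto dest: L2_D)
  have int: "integrable (lborel \<Otimes>\<^sub>M lborel) (\<lambda>(z, w). fock_kernel z w * g w * cnj (\<phi> z))"
  proof (rule Bochner_Integration.integrable_bound)
    have 1: "integrable (lborel \<Otimes>\<^sub>M lborel) (\<lambda>(z, w). cmod (fock_kernel z w) * (cmod (\<phi> z))\<^sup>2)"
      using bargmann_fock_L2[OF \<phi>] by (intro integrable_gaussian_convolution L2_integrable_square)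
    have sym: "cmod (fock_kernel z w) = cmod (fock_kernel w z)" for z w
      by (simp add: cmod_fock_kernel norm_minus_commute)
    have "integrable (lborel \<Otimes>\<^sub>M lborel) (\<lambda>(w, z). cmod (fock_kernel w z) * (cmod (g w))\<^sup>2)"
      using g by (intro integrable_gaussian_convolution L2_integrable_square)
    from lborel_pair.integrable_product_swap[OF this]
    have 2: "integrable (lborel \<Otimes>\<^sub>M lborel) (\<lambda>(z, w). cmod (fock_kernel z w) * (cmod (g w))\<^sup>2)"
      by (simp add: sym)
    show "integrable (lborel \<Otimes>\<^sub>M lborel) (\<lambda>p. (case p of (z, w) \<Rightarrow> cmod (fock_kernel z w) * (cmod (\<phi> z))\<^sup>2)
        + (case p of (z, w) \<Rightarrow> cmod (fock_kernel z w) * (cmod (g w))\<^sup>2))"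
      by (intro Bochner_Integration.integrable_add 1 2)
    show "(\<lambda>(z, w). fock_kernel z w * g w * cnj (\<phi> z)) \<in> borel_measurable (lborel \<Otimes>\<^sub>M lborel)"
      by measurable
    have "cmod (fock_kernel z w * g w * cnj (\<phi> z))
        \<le> cmod (fock_kernel z w) * (cmod (\<phi> z))\<^sup>2 + cmod (fock_kernel z w) * (cmod (g w))\<^sup>2" for z w
    proof -
      have "cmod (fock_kernel z w * g w * cnj (\<phi> z)) = cmod (fock_kernel z w) * cmod (\<phi> z * g w)"
        by (simp add: norm_mult)
      also have "\<dots> \<le> cmod (fock_kernel z w) * ((cmod (\<phi> z))\<^sup>2 + (cmod (g w))\<^sup>2)"
        by (intro mult_left_mono cmod_mult_le_sum_squares) simp
      finally show ?thesis by (simp add: distrib_left)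
    qed
    then show "AE p in lborel \<Otimes>\<^sub>M lborel. norm (case p of (z, w) \<Rightarrow> fock_kernel z w * g w * cnj (\<phi> z))
       \<le> norm ((case p of (z, w) \<Rightarrow> cmod (fock_kernel z w) * (cmod (\<phi> z))\<^sup>2)
        + (case p of (z, w) \<Rightarrow> cmod (fock_kernel z w) * (cmod (g w))\<^sup>2))"
      by (intro AE_I2) (auto simp: split_beta)
  qed
  have "(LINT z|lborel. bf_proj g z * cnj (\<phi> z))
      = (LINT z|lborel. LINT w|lborel. fock_kernel z w * g w * cnj (\<phi> z))"
    by (simp add: bf_proj_eq_kernel)
  also have "\<dots> = (LINT w|lborel. LINT z|lborel. fock_kernel z w * g w * cnj (\<phi> z))"
    by (rule lborel_pair.Fubini_integral[OF int, symmetric])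
  also have "\<dots> = (LINT w|lborel. g w * cnj (\<phi> w))"
  proof (rule Bochner_Integration.integral_cong[OF refl])
    fix w
    have "(LINT z|lborel. fock_kernel z w * g w * cnj (\<phi> z))
        = (LINT z|lborel. g w * cnj (fock_kernel w z * \<phi> z))"
      by (simp add: cnj_fock_kernel mult.commute mult.left_commute)
    also have "\<dots> = g w * cnj (bf_proj \<phi> w)"
      unfolding bf_proj_eq_kernel Bochner_Integration.integral_cnj[symmetric] by (rule integral_mult_right_zero)
    finally show "(LINT z|lborel. fock_kernel z w * g w * cnj (\<phi> z)) = g w * cnj (\<phi> w)"
      by (simp add: bf_proj_reproducing[OF \<phi>])
  qed
  finally show ?thesis .
qed

section \<open>The Bargmann-Fock space as a real inner product space\<close>

lemma bargmann_fock_zero: "(\<lambda>z. 0) \<in> bargmann_fock"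
  by (rule bargmann_fockI[of "\<lambda>z. 0"]) (auto simp: L2_def)

lemma L2_add:
  assumes "f \<in> L2" "g \<in> L2"
  shows "(\<lambda>z. f z + g z) \<in> L2"
proof -
  have [measurable]: "f \<in> borel_measurable borel" "g \<in> borel_measurable borel"
    using assms by (auto dest: L2_D)
  have bound: "(cmod (f z + g z))\<^sup>2 \<le> 2 * (cmod (f z))\<^sup>2 + 2 * (cmod (g z))\<^sup>2" for z
  proof -
    have "(cmod (f z + g z))\<^sup>2 \<le> (cmod (f z) + cmod (g z))\<^sup>2"
      by (intro power_mono norm_triangle_ineq) simp
    also have "\<dots> \<le> 2 * (cmod (f z))\<^sup>2 + 2 * (cmod (g z))\<^sup>2"
      using sum_squares_bound[of "cmod (f z)" "cmod (g z)"] by (simp add: power2_sum)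
    finally show ?thesis .
  qed
  have "integrable lborel (\<lambda>z. (cmod (f z + g z))\<^sup>2)"
  proof (rule Bochner_Integration.integrable_bound)
    show "integrable lborel (\<lambda>z. 2 * (cmod (f z))\<^sup>2 + 2 * (cmod (g z))\<^sup>2)"
      using assms by (intro Bochner_Integration.integrable_add integrable_mult_right L2_integrable_square)
  qed (use bound in auto)
  then show ?thesis by (simp add: L2_def)
qed

lemma bargmann_fock_add:
  assumes "u \<in> bargmann_fock" "v \<in> bargmann_fock"
  shows "(\<lambda>z. u z + v z) \<in> bargmann_fock"
proof -
  obtain f where f: "f holomorphic_on UNIV" "u = (\<lambda>z. of_real (exp (- (cmod z)\<^sup>2 / 2)) * f z)"
    using assms(1) by (rule bargmann_fockE)
  obtain g where g: "g holomorphic_on UNIV" "v = (\<lambda>z. of_real (exp (- (cmod z)\<^sup>2 / 2)) * g z)"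
    using assms(2) by (rule bargmann_fockE)
  from f g show ?thesis using assms[THEN bargmann_fock_L2]
    by (intro bargmann_fockI[of "\<lambda>z. f z + g z"] L2_add) (auto intro!: holomorphic_intros simp: distrib_left)
qed

lemma bargmann_fock_cmult:
  assumes "u \<in> bargmann_fock"
  shows "(\<lambda>z. c * u z) \<in> bargmann_fock"
proof -
  obtain f where "f holomorphic_on UNIV" "u = (\<lambda>z. of_real (exp (- (cmod z)\<^sup>2 / 2)) * f z)"
    using assms by (rule bargmann_fockE)
  then show ?thesis using assms[THEN bargmann_fock_L2]
    by (intro bargmann_fockI[of "\<lambda>z. c * f z"] L2_cmult) (auto intro!: holomorphic_intros)
qed

lemma bargmann_fock_uminus: "u \<in> bargmann_fock \<Longrightarrow> (\<lambda>z. - u z) \<in> bargmann_fock"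
  using bargmann_fock_cmult[of u "-1"] by simp

lemma bargmann_fock_diff:
  "u \<in> bargmann_fock \<Longrightarrow> v \<in> bargmann_fock \<Longrightarrow> (\<lambda>z. u z - v z) \<in> bargmann_fock"
  using bargmann_fock_add[of u "\<lambda>z. - v z"] by (simp add: bargmann_fock_uminus)

lemma L2_norm_square: "(L2_norm u)\<^sup>2 = (LINT z|lborel. (cmod (u z))\<^sup>2)"
  by (simp add: L2_norm_def)

text \<open>
  As a type, the Bargmann-Fock space carries the inner product \<open>Re \<langle>u, v\<rangle>\<close> of a real inner product
  space, so that differentiation of curves and product rules become those of normed spaces. Definiteness
  of the norm on functions, rather than on classes modulo null sets, is a consequence of the pointwise
  bound.
\<close>

typedef fock = bargmann_fock
  morphisms fock_fun Fock
  by (rule exI, rule bargmann_fock_zero)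

setup_lifting type_definition_fock

instantiation fock :: real_inner
begin

lift_definition zero_fock :: fock is "\<lambda>z. 0" by (rule bargmann_fock_zero)

lift_definition plus_fock :: "fock \<Rightarrow> fock \<Rightarrow> fock" is "\<lambda>u v z. u z + v z"
  by (rule bargmann_fock_add)

lift_definition minus_fock :: "fock \<Rightarrow> fock \<Rightarrow> fock" is "\<lambda>u v z. u z - v z"
  by (rule bargmann_fock_diff)

lift_definition uminus_fock :: "fock \<Rightarrow> fock" is "\<lambda>u z. - u z"
  by (rule bargmann_fock_uminus)

lift_definition scaleR_fock :: "real \<Rightarrow> fock \<Rightarrow> fock" is "\<lambda>r u z. of_real r * u z"
  by (rule bargmann_fock_cmult)

lift_definition inner_fock :: "fock \<Rightarrow> fock \<Rightarrow> real" is "\<lambda>u v. LINT z|lborel. Re (u z * cnj (v z))" .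

lift_definition norm_fock :: "fock \<Rightarrow> real" is L2_norm .

definition "dist_fock (u :: fock) v = norm (u - v)"
definition "sgn_fock (u :: fock) = inverse (norm u) *\<^sub>R u"
definition "(uniformity :: (fock \<times> fock) filter) = (INF e\<in>{0<..}. principal {(u, v). dist u v < e})"
definition "open (U :: fock set) \<longleftrightarrow> (\<forall>u\<in>U. \<forall>\<^sub>F (u', v) in uniformity. u' = u \<longrightarrow> v \<in> U)"

instance
proof
  have int: "integrable lborel (\<lambda>z. Re (u z * cnj (v z)))"
    if "u \<in> bargmann_fock" "v \<in> bargmann_fock" for u v
    using that by (intro integrable_Re L2_integrable_mult L2_cnj bargmann_fock_L2)
  have self: "(LINT z|lborel. Re (u z * cnj (u z))) = (L2_norm u)\<^sup>2" for u
    unfolding L2_norm_square cmod_power2 by (simp add: power2_eq_square)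
  fix a b c :: fock and r s :: real
  show "a + b + c = a + (b + c)" by transfer (simp add: add.assoc)
  show "a + b = b + a" by transfer (simp add: add.commute)
  show "0 + a = a" by transfer simp
  show "- a + a = 0" by transfer simp
  show "a - b = a + - b" by transfer simp
  show "r *\<^sub>R (a + b) = r *\<^sub>R a + r *\<^sub>R b" by transfer (simp add: distrib_left)
  show "(r + s) *\<^sub>R a = r *\<^sub>R a + s *\<^sub>R a" by transfer (simp add: distrib_right)
  show "r *\<^sub>R s *\<^sub>R a = (r * s) *\<^sub>R a" by transfer (simp add: mult.assoc)
  show "1 *\<^sub>R a = a" by transfer simp
  show "dist a b = norm (a - b)" by (simp add: dist_fock_def)
  show "sgn a = inverse (norm a) *\<^sub>R a" by (simp add: sgn_fock_def)
  show "uniformity = (INF e\<in>{0<..}. principal {(u :: fock, v). dist u v < e})"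
    by (rule uniformity_fock_def)
  show "open U \<longleftrightarrow> (\<forall>u\<in>U. \<forall>\<^sub>F (u', v) in uniformity. u' = u \<longrightarrow> v \<in> U)" for U :: "fock set"
    by (rule open_fock_def)
  show "inner a b = inner b a" by transfer (simp add: mult.commute)
  show "inner (a + b) c = inner a c + inner b c"
    by transfer (use int in \<open>simp add: distrib_right flip: Bochner_Integration.integral_add\<close>)
  show "inner (r *\<^sub>R a) b = r * inner a b"
    by transfer (simp add: mult.assoc flip: integral_mult_right_zero)
  show "0 \<le> inner a a" by transfer (simp only: self zero_le_power2)
  show "inner a a = 0 \<longleftrightarrow> a = 0"
  proof transfer
    fix u assume u: "u \<in> bargmann_fock"
    show "(LINT z|lborel. Re (u z * cnj (u z))) = 0 \<longleftrightarrow> u = (\<lambda>z. 0)"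
    proof
      assume "(LINT z|lborel. Re (u z * cnj (u z))) = 0"
      then have "L2_norm u = 0" unfolding self by simp
      then show "u = (\<lambda>z. 0)" using bargmann_fock_pointwise_bound[OF u] by (simp add: fun_eq_iff)
    qed simp
  qed
  show "norm a = sqrt (inner a a)" by transfer (simp only: self, simp add: L2_norm_def)
qed

end

lemma fock_derivativeI:
  assumes "has_bf_derivative u D t"
  shows "((\<lambda>s. Fock (u s)) has_vector_derivative Fock D) (at t)"
proof -
  have mem: "u s \<in> bargmann_fock" "D \<in> bargmann_fock" for s
    using assms by (auto simp: has_bf_derivative_def)
  have lim: "((\<lambda>h. L2_norm (\<lambda>z. (u (t + h) z - u t z) / of_real h - D z)) \<longlongrightarrow> 0) (at 0)"
    using assms by (auto simp: has_bf_derivative_def)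
  have eq: "norm (Fock (u (t + h)) - Fock (u t) - h *\<^sub>R Fock D) / norm h
      = L2_norm (\<lambda>z. (u (t + h) z - u t z) / of_real h - D z)" if "h \<noteq> 0" for h
  proof -
    have "norm (Fock (u (t + h)) - Fock (u t) - h *\<^sub>R Fock D) / norm h
        = norm ((Fock (u (t + h)) - Fock (u t) - h *\<^sub>R Fock D) /\<^sub>R h)"
      by (simp add: divide_inverse mult.commute)
    also have "(Fock (u (t + h)) - Fock (u t) - h *\<^sub>R Fock D) /\<^sub>R h
        = (Fock (u (t + h)) - Fock (u t)) /\<^sub>R h - Fock D"
      using that by (simp add: scaleR_right_diff_distrib)
    also have "norm \<dots> = L2_norm (\<lambda>z. (u (t + h) z - u t z) / of_real h - D z)"
      by (simp add: norm_fock.rep_eq minus_fock.rep_eq scaleR_fock.rep_eq Fock_inverse mem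
          divide_inverse mult.commute)
    finally show ?thesis .
  qed
  have "((\<lambda>h. norm (Fock (u (t + h)) - Fock (u t) - h *\<^sub>R Fock D) / norm h) \<longlongrightarrow> 0) (at 0)"
    using lim by (rule Lim_transform_eventually) (auto simp: eventually_at_filter eq[symmetric])
  then show ?thesis
    by (simp add: has_vector_derivative_def has_derivative_at bounded_linear_scaleR_left)
qed

section \<open>The Hamiltonian as the squared norm of a bilinear map\<close>

text \<open>
  The product of two elements carries the Gaussian weight \<open>exp (- \<bar>z\<bar>\<^sup>2)\<close>, which the dilation by
  \<open>sqrt 2\<close> turns back into \<open>exp (- \<bar>z\<bar>\<^sup>2 / 2)\<close>. Square integrability holds because one factor is
  bounded.
\<close>

lemma bargmann_fock_dilated_mult:
  assumes u: "u \<in> bargmann_fock" and v: "v \<in> bargmann_fock"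
  shows "(\<lambda>z. u (z /\<^sub>R sqrt 2) * v (z /\<^sub>R sqrt 2)) \<in> bargmann_fock"
proof -
  obtain f where f: "f holomorphic_on UNIV" "u = (\<lambda>z. of_real (exp (- (cmod z)\<^sup>2 / 2)) * f z)"
    using u by (rule bargmann_fockE)
  obtain g where g: "g holomorphic_on UNIV" "v = (\<lambda>z. of_real (exp (- (cmod z)\<^sup>2 / 2)) * g z)"
    using v by (rule bargmann_fockE)
  have [measurable]: "u \<in> borel_measurable borel" "v \<in> borel_measurable borel"
    using assms[THEN bargmann_fock_L2] by (auto dest: L2_D)
  show ?thesis
  proof (rule bargmann_fockI)
    have dil: "(\<lambda>z. z /\<^sub>R sqrt 2) holomorphic_on UNIV"
      unfolding scaleR_conv_of_real by (intro holomorphic_intros)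
    show "(\<lambda>z. f (z /\<^sub>R sqrt 2) * g (z /\<^sub>R sqrt 2)) holomorphic_on UNIV"
      by (intro holomorphic_on_mult holomorphic_on_compose_gen[OF dil f(1), unfolded o_def]
          holomorphic_on_compose_gen[OF dil g(1), unfolded o_def]) auto
    have "exp (- (cmod (z /\<^sub>R sqrt 2))\<^sup>2 / 2) * exp (- (cmod (z /\<^sub>R sqrt 2))\<^sup>2 / 2) = exp (- (cmod z)\<^sup>2 / 2)" for z
      unfolding exp_add[symmetric] by (simp add: power_mult_distrib field_simps)
    then have E: "complex_of_real (exp (- (cmod (z /\<^sub>R sqrt 2))\<^sup>2 / 2)) * of_real (exp (- (cmod (z /\<^sub>R sqrt 2))\<^sup>2 / 2))
       = of_real (exp (- (cmod z)\<^sup>2 / 2))" for z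
      unfolding of_real_mult[symmetric] by simp
    have rearr: "(a * x) * (a * y) = (a * a) * (x * y)" for a x y :: complex by (simp add: mult_ac)
    show "(\<lambda>z. u (z /\<^sub>R sqrt 2) * v (z /\<^sub>R sqrt 2))
        = (\<lambda>z. of_real (exp (- (cmod z)\<^sup>2 / 2)) * (f (z /\<^sub>R sqrt 2) * g (z /\<^sub>R sqrt 2)))"
      unfolding f(2) g(2) by (rule ext, subst rearr, subst E, rule refl)
    have "(\<lambda>z. u z * v z) \<in> L2"
      by (rule L2_bounded_mult[OF bargmann_fock_L2[OF v] _ bargmann_fock_pointwise_bound[OF u]]) simp
    then show "(\<lambda>z. u (z /\<^sub>R sqrt 2) * v (z /\<^sub>R sqrt 2)) \<in> L2"
      using integral_dilate_complex(2)[of "sqrt 2" "\<lambda>z. (cmod (u z * v z))\<^sup>2"]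
      by (simp add: L2_def)
  qed
qed

text \<open>
  This bilinear map turns the quartic functional \<^const>\<open>hamiltonian\<close> into half a squared norm, see
  \<open>norm_dilated_mult\<close>; the factor comes from the Jacobian of the dilation.
\<close>

lift_definition dilated_mult :: "fock \<Rightarrow> fock \<Rightarrow> fock" is
  "\<lambda>u v z. u (z /\<^sub>R sqrt 2) * v (z /\<^sub>R sqrt 2)"
  by (rule bargmann_fock_dilated_mult)

lemma fock_fun_measurable [measurable]: "fock_fun u \<in> borel_measurable borel"
  using fock_fun[of u] by (auto dest: L2_D bargmann_fock_L2)

lemma inner_dilated_mult:
  "inner (dilated_mult a b) (dilated_mult c d)
    = 2 * (LINT z|lborel. Re (fock_fun a z * fock_fun b z * cnj (fock_fun c z * fock_fun d z)))"
  using integral_dilate_complex(1)[of "sqrt 2"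
      "\<lambda>z. Re (fock_fun a z * fock_fun b z * cnj (fock_fun c z * fock_fun d z))"]
  by (simp add: inner_fock.rep_eq dilated_mult.rep_eq)

lemma norm_dilated_mult:
  "(norm (dilated_mult a b))\<^sup>2 = 2 * hamiltonian (fock_fun a) (fock_fun b)"
proof -
  have "Re (x * y * cnj (x * y)) = (cmod x)\<^sup>2 * (cmod y)\<^sup>2" for x y
    by (simp only: complex_norm_square[symmetric] Re_complex_of_real norm_mult power_mult_distrib)
  then show ?thesis
    unfolding power2_norm_eq_inner inner_dilated_mult hamiltonian_def by (simp only:)
qed

lemma fock_fun_bound: "cmod (fock_fun a z) \<le> norm a / sqrt pi"
  by transfer (rule bargmann_fock_pointwise_bound)

lemma fock_fun_integrable_square: "integrable lborel (\<lambda>z. (cmod (fock_fun a z))\<^sup>2)"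
  by transfer (rule L2_integrable_square[OF bargmann_fock_L2])

lemma integral_fock_fun_square: "(LINT z|lborel. (cmod (fock_fun a z))\<^sup>2) = (norm a)\<^sup>2"
  by (simp add: norm_fock.rep_eq L2_norm_square)

text \<open>
  Of the two factors \<open>\<bar>a z\<bar>\<close> one is estimated by \<open>M\<close> and the other by the pointwise bound. Taking \<open>M\<close> to be
  the supremum norm gives the lower bounds of the proposition; taking \<open>M\<close> to be the pointwise bound
  gives continuity of \<^const>\<open>dilated_mult\<close>.
\<close>

lemma hamiltonian_le:
  assumes "AE z in lborel. cmod (fock_fun a z) \<le> M"
  shows "hamiltonian (fock_fun a) (fock_fun b) \<le> M * (norm a / sqrt pi) * (norm b)\<^sup>2"
proof -
  have bound: "AE z in lborel. (cmod (fock_fun a z))\<^sup>2 * (cmod (fock_fun b z))\<^sup>2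
      \<le> M * (norm a / sqrt pi) * (cmod (fock_fun b z))\<^sup>2"
    using assms
  proof eventually_elim
    case (elim z)
    have "(cmod (fock_fun a z))\<^sup>2 \<le> M * (norm a / sqrt pi)"
      unfolding power2_eq_square using elim fock_fun_bound[of a z]
      by (intro mult_mono) (auto intro: order_trans[OF norm_ge_zero])
    then show ?case by (rule mult_right_mono) simp
  qed
  have "hamiltonian (fock_fun a) (fock_fun b)
      \<le> (LINT z|lborel. M * (norm a / sqrt pi) * (cmod (fock_fun b z))\<^sup>2)"
    unfolding hamiltonian_def
  proof (rule integral_mono_AE[OF _ _ bound])
    show "integrable lborel (\<lambda>z. M * (norm a / sqrt pi) * (cmod (fock_fun b z))\<^sup>2)"
      by (intro integrable_mult_right fock_fun_integrable_square)
    then show "integrable lborel (\<lambda>z. (cmod (fock_fun a z))\<^sup>2 * (cmod (fock_fun b z))\<^sup>2)"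
    proof (rule Bochner_Integration.integrable_bound)
      show "AE z in lborel. norm ((cmod (fock_fun a z))\<^sup>2 * (cmod (fock_fun b z))\<^sup>2)
          \<le> norm (M * (norm a / sqrt pi) * (cmod (fock_fun b z))\<^sup>2)"
        using bound
      proof eventually_elim
        case (elim z)
        show ?case
          unfolding real_norm_def by (rule order_trans[OF eq_refl order_trans[OF elim abs_ge_self]]) simp
      qed
    qed simp
  qed
  then show ?thesis by (simp add: integral_fock_fun_square)
qed

lemma bounded_bilinear_dilated_mult: "bounded_bilinear dilated_mult"
proof
  fix a a' b b' :: fock and r :: real
  show "dilated_mult (a + a') b = dilated_mult a b + dilated_mult a' b"
    by transfer (simp add: distrib_right)
  show "dilated_mult a (b + b') = dilated_mult a b + dilated_mult a b'"
    by transfer (simp add: distrib_left)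
  show "dilated_mult (r *\<^sub>R a) b = r *\<^sub>R dilated_mult a b"
    by transfer (simp add: mult.assoc)
  show "dilated_mult a (r *\<^sub>R b) = r *\<^sub>R dilated_mult a b"
    by transfer (simp add: mult.left_commute)
  show "\<exists>K. \<forall>a b. norm (dilated_mult a b) \<le> norm a * norm b * K"
  proof (intro exI allI)
    fix a b
    have "(norm (dilated_mult a b))\<^sup>2 \<le> 2 * (norm a / sqrt pi * (norm a / sqrt pi) * (norm b)\<^sup>2)"
      unfolding norm_dilated_mult by (intro mult_left_mono hamiltonian_le) (auto simp: fock_fun_bound)
    also have "\<dots> = (norm a * norm b * sqrt (2 / pi))\<^sup>2"
      by (simp add: power_mult_distrib power_divide real_sqrt_divide) (simp add: power2_eq_square)
    finally show "norm (dilated_mult a b) \<le> norm a * norm b * sqrt (2 / pi)"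
      by (rule power2_le_imp_le) simp
  qed
qed

section \<open>Conservation laws\<close>

lemma norm_constant_if_derivative_orthogonal:
  fixes F :: "real \<Rightarrow> 'a::real_inner"
  assumes deriv: "\<And>t. (F has_vector_derivative F' t) (at t)"
    and orth: "\<And>t. inner (F t) (F' t) = 0"
  shows "norm (F s) = norm (F t)"
proof -
  have "((\<lambda>s. inner (F s) (F s)) has_real_derivative 0) (at t)" for t
    using bounded_bilinear.has_vector_derivative[OF bounded_bilinear_inner deriv deriv, of t] orth
    by (simp add: has_real_derivative_iff_has_vector_derivative inner_commute)
  then have "inner (F s) (F s) = inner (F t) (F t)"
    using DERIV_isconst_all by blast
  then show ?thesis by (simp add: norm_eq_sqrt_inner)
qed

text \<open>
  With \<open>g = \<bar>v\<bar>\<^sup>2 u\<close> the equation reads \<open>\<i> D = \<sigma> \<Pi> g\<close>. Pairing with \<open>u\<close> gives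
  \<open>\<i> \<langle>D, u\<rangle> = \<sigma> \<langle>\<Pi> g, u\<rangle> = \<sigma> \<langle>g, u\<rangle>\<close>, which is real because \<open>\<langle>g, u\<rangle>\<close> is the integral of
  \<open>\<bar>u\<bar>\<^sup>2 \<bar>v\<bar>\<^sup>2\<close>. Pairing with \<open>D\<close> gives \<open>\<langle>g, D\<rangle> = \<langle>\<Pi> g, D\<rangle> = \<i> \<sigma> \<langle>D, D\<rangle>\<close>, which is purely
  imaginary. The first orthogonality conserves the mass, the second the Hamiltonian.
\<close>

lemma flow_orthogonality:
  assumes u: "u \<in> bargmann_fock" and v: "v \<in> bargmann_fock" and D: "D \<in> bargmann_fock"
    and \<sigma>: "\<sigma> \<in> {1, -1}"
    and eq: "\<forall>z. \<i> * D z = of_real \<sigma> * bf_proj (\<lambda>w. of_real ((cmod (v w))\<^sup>2) * u w) z"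
  shows "(LINT z|lborel. Re (u z * cnj (D z))) = 0"
    and "(LINT z|lborel. Re (of_real ((cmod (v z))\<^sup>2) * u z * cnj (D z))) = 0"
proof -
  have [measurable]: "u \<in> borel_measurable borel" "v \<in> borel_measurable borel"
    using u v bargmann_fock_L2 by (auto dest: L2_D)
  define g where "g = (\<lambda>w. of_real ((cmod (v w))\<^sup>2) * u w)"
  have g: "g \<in> L2"
    unfolding g_def
  proof (rule L2_bounded_mult)
    show "cmod (of_real ((cmod (v z))\<^sup>2)) \<le> (L2_norm v / sqrt pi)\<^sup>2" for z
      using bargmann_fock_pointwise_bound[OF v, of z] by (simp add: power_mono norm_power)
  qed (use u in \<open>auto intro: bargmann_fock_L2\<close>)
  have proj: "bf_proj g z = of_real \<sigma> * \<i> * D z" for z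
    using eq \<sigma> by (auto simp: g_def)
  have uD: "integrable lborel (\<lambda>z. D z * cnj (u z))"
    using u D by (intro L2_integrable_mult L2_cnj bargmann_fock_L2)
  have "of_real \<sigma> * \<i> * (LINT z|lborel. D z * cnj (u z)) = (LINT z|lborel. bf_proj g z * cnj (u z))"
    unfolding proj by (simp only: mult.assoc integral_mult_right_zero)
  also have "\<dots> = (LINT z|lborel. g z * cnj (u z))"
    by (rule bf_proj_self_adjoint[OF g u])
  also have "\<dots> = (LINT z|lborel. of_real ((cmod (v z))\<^sup>2 * (cmod (u z))\<^sup>2))"
    unfolding g_def by (simp only: mult.assoc of_real_mult complex_norm_square)
  also have "\<dots> = of_real (LINT z|lborel. (cmod (v z))\<^sup>2 * (cmod (u z))\<^sup>2)"
    by (rule integral_complex_of_real)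
  finally have "Re (LINT z|lborel. D z * cnj (u z)) = 0"
    using \<sigma> by (auto simp: complex_eq_iff)
  then have "(LINT z|lborel. Re (D z * cnj (u z))) = 0"
    using integral_Re[OF uD] by simp
  then show "(LINT z|lborel. Re (u z * cnj (D z))) = 0"
    by (simp add: mult.commute)
  have gD: "integrable lborel (\<lambda>z. g z * cnj (D z))"
    by (intro L2_integrable_mult L2_cnj g bargmann_fock_L2[OF D])
  have "(LINT z|lborel. g z * cnj (D z)) = (LINT z|lborel. bf_proj g z * cnj (D z))"
    by (rule bf_proj_self_adjoint[OF g D, symmetric])
  also have "\<dots> = of_real \<sigma> * \<i> * (LINT z|lborel. D z * cnj (D z))"
    unfolding proj by (simp only: mult.assoc integral_mult_right_zero)
  also have "\<dots> = of_real \<sigma> * \<i> * of_real (LINT z|lborel. (cmod (D z))\<^sup>2)"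
    unfolding complex_norm_square[symmetric] integral_complex_of_real ..
  finally have "Re (LINT z|lborel. g z * cnj (D z)) = 0"
    by simp
  then show "(LINT z|lborel. Re (of_real ((cmod (v z))\<^sup>2) * u z * cnj (D z))) = 0"
    using integral_Re[OF gD] by (simp add: g_def)
qed

text \<open>
  Both equations have the shape treated in \<open>flow_orthogonality\<close>, the first with sign \<open>1\<close>. Each
  conserved quantity is the norm of a differentiable curve: \<open>u\<close>, \<open>v\<close>, and the dilated product of \<open>u\<close>
  and \<open>v\<close>. By the product rule the derivative of the last one paired with the curve itself is a sum of
  two terms, each of which vanishes by the orthogonality for one of the two equations.
\<close>

lemma conservation_laws:
  assumes \<sigma>: "\<sigma> \<in> {1, -1}" and sol: "solves_system \<sigma> u\<^sub>0 v\<^sub>0 u v"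
  shows "L2_norm (u t) = L2_norm u\<^sub>0" "L2_norm (v t) = L2_norm v\<^sub>0"
    and "hamiltonian (u t) (v t) = hamiltonian u\<^sub>0 v\<^sub>0"
proof -
  have init: "u 0 = u\<^sub>0" "v 0 = v\<^sub>0" using sol by (auto simp: solves_system_def)
  obtain du dv where d: "\<And>t. has_bf_derivative u (du t) t" "\<And>t. has_bf_derivative v (dv t) t"
    and du: "\<And>t. \<forall>z. \<i> * du t z = of_real 1 * bf_proj (\<lambda>w. of_real ((cmod (v t w))\<^sup>2) * u t w) z"
    and dv: "\<And>t. \<forall>z. \<i> * dv t z = of_real \<sigma> * bf_proj (\<lambda>w. of_real ((cmod (u t w))\<^sup>2) * v t w) z"
    using sol unfolding solves_system_def of_real_1 mult_1 by metis
  have mem: "u t \<in> bargmann_fock" "v t \<in> bargmann_fock" "du t \<in> bargmann_fock" "dv t \<in> bargmann_fock" for t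
    using d by (auto simp: has_bf_derivative_def)
  define U V dU dV where "U = (\<lambda>t. Fock (u t))" "V = (\<lambda>t. Fock (v t))"
    and "dU = (\<lambda>t. Fock (du t))" "dV = (\<lambda>t. Fock (dv t))"
  note defs = this
  have rep: "fock_fun (U t) = u t" "fock_fun (V t) = v t" "fock_fun (dU t) = du t" "fock_fun (dV t) = dv t" for t
    by (simp_all add: defs Fock_inverse mem)
  have U: "(U has_vector_derivative dU t) (at t)" and V: "(V has_vector_derivative dV t) (at t)" for t
    unfolding defs by (intro fock_derivativeI d)+
  have one: "(1::real) \<in> {1, -1}" by simp
  note ou = flow_orthogonality[OF mem(1,2,3) one du]
  note ov = flow_orthogonality[OF mem(2,1,4) \<sigma> dv]
  have "norm (U t) = norm (U 0)"
    using U by (rule norm_constant_if_derivative_orthogonal) (simp only: inner_fock.rep_eq rep ou)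
  then show "L2_norm (u t) = L2_norm u\<^sub>0" by (simp add: norm_fock.rep_eq rep init)
  have "norm (V t) = norm (V 0)"
    using V by (rule norm_constant_if_derivative_orthogonal) (simp only: inner_fock.rep_eq rep ov)
  then show "L2_norm (v t) = L2_norm v\<^sub>0" by (simp add: norm_fock.rep_eq rep init)
  have "norm (dilated_mult (U t) (V t)) = norm (dilated_mult (U 0) (V 0))"
  proof (rule norm_constant_if_derivative_orthogonal)
    fix t
    show "((\<lambda>t. dilated_mult (U t) (V t)) has_vector_derivative
        dilated_mult (U t) (dV t) + dilated_mult (dU t) (V t)) (at t)"
      by (rule bounded_bilinear.has_vector_derivative[OF bounded_bilinear_dilated_mult U V])
    have "u t z * v t z * cnj (u t z * dv t z) = of_real ((cmod (u t z))\<^sup>2) * v t z * cnj (dv t z)" for z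
      unfolding complex_norm_square by (simp add: mult_ac)
    moreover have "u t z * v t z * cnj (du t z * v t z) = of_real ((cmod (v t z))\<^sup>2) * u t z * cnj (du t z)" for z
      unfolding complex_norm_square by (simp add: mult_ac)
    ultimately show "inner (dilated_mult (U t) (V t)) (dilated_mult (U t) (dV t) + dilated_mult (dU t) (V t)) = 0"
      unfolding inner_add_right inner_dilated_mult rep by (simp only: ou ov)
  qed
  then have "(norm (dilated_mult (U t) (V t)))\<^sup>2 = (norm (dilated_mult (U 0) (V 0)))\<^sup>2" by simp
  then show "hamiltonian (u t) (v t) = hamiltonian u\<^sub>0 v\<^sub>0"
    unfolding norm_dilated_mult by (simp add: rep init)
qed

section \<open>Supremum bounds\<close>

lemma Linf_norm_le:
  assumes u: "u \<in> bargmann_fock"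
  shows "Linf_norm u \<le> ereal (L2_norm u / sqrt pi)"
  unfolding Linf_norm_def
  using bargmann_fock_L2[OF u, THEN L2_D] bargmann_fock_pointwise_bound[OF u]
  by (intro esssup_I AE_I2) auto

text \<open>
  If one of the functions has norm \<open>0\<close>, the quotient on the left is \<open>0\<close> because its denominator
  vanishes, and the claim reduces to nonnegativity of the essential supremum.
\<close>

lemma Linf_norm_ge:
  assumes u: "u \<in> bargmann_fock" and v: "v \<in> bargmann_fock"
  shows "ereal (sqrt pi * hamiltonian u v / (L2_norm u * (L2_norm v)\<^sup>2)) \<le> Linf_norm u"
proof -
  have AE: "AE z in lborel. ereal (cmod (u z)) \<le> Linf_norm u"
    unfolding Linf_norm_def by (rule esssup_AE)
  have "(AE z in (lborel :: complex measure). (0::ereal) \<le> Linf_norm u)"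
    using AE by eventually_elim (auto intro: order_trans[rotated])
  then have "0 \<le> Linf_norm u"
    by (simp add: eventually_const ae_filter_eq_bot_iff)
  then obtain M where M: "Linf_norm u = ereal M" "0 \<le> M"
    using Linf_norm_le[OF u] by (cases "Linf_norm u") auto
  have "hamiltonian u v \<le> M * (L2_norm u / sqrt pi) * (L2_norm v)\<^sup>2"
    using hamiltonian_le[of "Fock u" M "Fock v"] AE u v
    by (simp add: M norm_fock.rep_eq Fock_inverse)
  then have "sqrt pi * hamiltonian u v \<le> M * (L2_norm u * (L2_norm v)\<^sup>2)"
    by (simp add: field_simps)
  moreover have "0 \<le> L2_norm u * (L2_norm v)\<^sup>2" by (simp add: L2_norm_def)
  ultimately have "sqrt pi * hamiltonian u v / (L2_norm u * (L2_norm v)\<^sup>2) \<le> M"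
    using M(2) by (cases "L2_norm u * (L2_norm v)\<^sup>2 = 0") (auto simp: field_simps less_le)
  then show ?thesis by (simp add: M)
qed

lemma hamiltonian_commute: "hamiltonian u v = hamiltonian v u"
  by (simp add: hamiltonian_def mult.commute)

theorem proposition1p2:
  fixes \<sigma> :: real and u\<^sub>0 v\<^sub>0 :: "complex \<Rightarrow> complex"
    and u v :: "real \<Rightarrow> complex \<Rightarrow> complex"
  assumes "\<sigma> \<in> {1, -1}"
    and "u\<^sub>0 \<in> bargmann_fock" and "v\<^sub>0 \<in> bargmann_fock"
    and "solves_system \<sigma> u\<^sub>0 v\<^sub>0 u v"
  shows "\<forall>t. ereal (sqrt pi * hamiltonian u\<^sub>0 v\<^sub>0 / (L2_norm u\<^sub>0 * (L2_norm v\<^sub>0)\<^sup>2))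
               \<le> Linf_norm (u t) \<and>
             Linf_norm (u t) \<le> ereal (1 / sqrt pi * L2_norm u\<^sub>0) \<and>
             ereal (sqrt pi * hamiltonian u\<^sub>0 v\<^sub>0 / (L2_norm v\<^sub>0 * (L2_norm u\<^sub>0)\<^sup>2))
               \<le> Linf_norm (v t) \<and>
             Linf_norm (v t) \<le> ereal (1 / sqrt pi * L2_norm v\<^sub>0)"
proof
  fix t
  have mem: "u t \<in> bargmann_fock" "v t \<in> bargmann_fock"
    using assms(4) unfolding solves_system_def has_bf_derivative_def by meson+
  note cons = conservation_laws[OF assms(1,4), of t]
  show "ereal (sqrt pi * hamiltonian u\<^sub>0 v\<^sub>0 / (L2_norm u\<^sub>0 * (L2_norm v\<^sub>0)\<^sup>2))
               \<le> Linf_norm (u t) \<and>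
             Linf_norm (u t) \<le> ereal (1 / sqrt pi * L2_norm u\<^sub>0) \<and>
             ereal (sqrt pi * hamiltonian u\<^sub>0 v\<^sub>0 / (L2_norm v\<^sub>0 * (L2_norm u\<^sub>0)\<^sup>2))
               \<le> Linf_norm (v t) \<and>
             Linf_norm (v t) \<le> ereal (1 / sqrt pi * L2_norm v\<^sub>0)"
    using Linf_norm_ge[OF mem] Linf_norm_le[OF mem(1)] Linf_norm_ge[OF mem(2,1)] Linf_norm_le[OF mem(2)]
    by (simp add: cons hamiltonian_commute[of "v t"])
qed

end
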